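(* Let $k\geq 2$ be an integer. For $n\geq 0$ let $ud(n)$, $dd(n)$, $uu(n)$, $du(n)$ denote, respectively, the numbers of up-down, down-down, up-up and down-up permutations of length $n$ that avoid both $1\mbox{-}3\mbox{-}2$ and $1\mbox{-}2\mbox{-}\cdots\mbox{-}k$, and let $UD(x)=\sum_{n\geq0}ud(n)x^n$, $DD(x)=\sum_{n\ge0}dd(n)x^n$, $UU(x)=\sum_{n\ge0}uu(n)x^n$, $DU(x)=\sum_{n\ge0}du(n)x^n$. Then, writing $U_r$ for $U_r\!\left(\frac{1}{2x}\right)$, (1) $UD(x)=\dfrac{xU_{k-3}}{U_{k-1}}$; (2) $DD(x)=\dfrac{x^{k-1}+U_{k-3}}{U_{k-1}}$; (3) $UU(x)=\dfrac{U_{k-3}}{U_{k-1}}$; (4) $DU(x)=\dfrac{x^{k-1}+U_{k-3}}{xU_{k-1}}-x$.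
   Context: A permutation of length $n$ is a word $\pi_1\cdots\pi_n$ containing each of $1,\dots,n$ exactly once. For a permutation $\tau$ of length $m$, the classical pattern $\tau$ (written with dashes between letters, e.g. $1\mbox{-}3\mbox{-}2$, $1\mbox{-}2\mbox{-}\cdots\mbox{-}k$) occurs in $\pi$ at indices $i_1<\dots<i_m$ if $\pi_{i_1}\cdots\pi_{i_m}$ is order-isomorphic to $\tau$; $\pi$ avoids $\tau$ if there is no occurrence. Thus $1\mbox{-}3\mbox{-}2$ is the classical pattern $132$ and $1\mbox{-}2\mbox{-}\cdots\mbox{-}k$ is an increasing subsequence of length $k$. For $n\ge2$: up-down permutations satisfy $\pi_1<\pi_2>\pi_3<\cdots$ and have odd length; up-up permutations satisfy $\pi_1<\pi_2>\pi_3<\cdots$ and have even length; down-up permutations satisfy $\pi_1>\pi_2<\pi_3>\cdots$ and have odd length; down-down permutations satisfy $\pi_1>\pi_2<\pi_3>\cdots$ and have even length. For $n=0,1$ none of these four classes has any element. $U_r$ denotes the Chebyshev polynomial of the second kind, $U_r(\cos\theta)=\frac{\sin((r+1)\theta)}{\sin\theta}$, so $U_{-1}(t)=0$, $U_0(t)=1$, $U_1(t)=2t$, $U_r(t)=2tU_{r-1}(t)-U_{r-2}(t)$. *)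

theory Defs
  imports
    "HOL-Combinatorics.Multiset_Permutations"
    "HOL-Computational_Algebra.Formal_Laurent_Series"
    Complex_Main
begin

definition order_isomorphic :: "nat list \<Rightarrow> nat list \<Rightarrow> bool" where
  "order_isomorphic u v \<longleftrightarrow> length u = length v \<and>
     (\<forall>i<length u. \<forall>j<length u. u ! i < u ! j \<longleftrightarrow> v ! i < v ! j)"

definition occurs_at :: "nat list \<Rightarrow> nat list \<Rightarrow> nat list \<Rightarrow> bool" where
  "occurs_at \<tau> \<pi> is \<longleftrightarrow> sorted_wrt (<) is \<and> set is \<subseteq> {..<length \<pi>} \<and>
     order_isomorphic (map (\<lambda>i. \<pi> ! i) is) \<tau>"

definition avoids :: "nat list \<Rightarrow> nat list \<Rightarrow> bool" where
  "avoids \<pi> \<tau> \<longleftrightarrow> (\<nexists>is. occurs_at \<tau> \<pi> is)"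

text \<open>List positions start at 0, so an initial ascent is a comparison at the even position 0.\<close>

definition alternating_from_up :: "nat list \<Rightarrow> bool" where
  "alternating_from_up \<pi> \<longleftrightarrow> (\<forall>i. Suc i < length \<pi> \<longrightarrow>
     (if even i then \<pi> ! i < \<pi> ! Suc i else \<pi> ! i > \<pi> ! Suc i))"

definition alternating_from_down :: "nat list \<Rightarrow> bool" where
  "alternating_from_down \<pi> \<longleftrightarrow> (\<forall>i. Suc i < length \<pi> \<longrightarrow>
     (if even i then \<pi> ! i > \<pi> ! Suc i else \<pi> ! i < \<pi> ! Suc i))"

text \<open>The two words in each name describe the first and the last step of the permutation;
  words of length 0 and 1 are excluded from all four classes.\<close>

definition up_down :: "nat list \<Rightarrow> bool" where
  "up_down \<pi> \<longleftrightarrow> length \<pi> \<ge> 2 \<and> odd (length \<pi>) \<and> alternating_from_up \<pi>"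

definition up_up :: "nat list \<Rightarrow> bool" where
  "up_up \<pi> \<longleftrightarrow> length \<pi> \<ge> 2 \<and> even (length \<pi>) \<and> alternating_from_up \<pi>"

definition down_up :: "nat list \<Rightarrow> bool" where
  "down_up \<pi> \<longleftrightarrow> length \<pi> \<ge> 2 \<and> odd (length \<pi>) \<and> alternating_from_down \<pi>"

definition down_down :: "nat list \<Rightarrow> bool" where
  "down_down \<pi> \<longleftrightarrow> length \<pi> \<ge> 2 \<and> even (length \<pi>) \<and> alternating_from_down \<pi>"

definition avoiders :: "nat \<Rightarrow> nat \<Rightarrow> nat list set" where
  "avoiders k n = {\<pi> \<in> permutations_of_set {1..n}. avoids \<pi> [1, 3, 2] \<and> avoids \<pi> [1..<Suc k]}"

definition ud :: "nat \<Rightarrow> nat \<Rightarrow> nat" where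
  "ud k n = card {\<pi> \<in> avoiders k n. up_down \<pi>}"

definition dd :: "nat \<Rightarrow> nat \<Rightarrow> nat" where
  "dd k n = card {\<pi> \<in> avoiders k n. down_down \<pi>}"

definition uu :: "nat \<Rightarrow> nat \<Rightarrow> nat" where
  "uu k n = card {\<pi> \<in> avoiders k n. up_up \<pi>}"

definition du :: "nat \<Rightarrow> nat \<Rightarrow> nat" where
  "du k n = card {\<pi> \<in> avoiders k n. down_up \<pi>}"

definition gen_fun :: "(nat \<Rightarrow> nat) \<Rightarrow> real fls" where
  "gen_fun a = fps_to_fls (Abs_fps (\<lambda>n. of_nat (a n)))"

text \<open>The index is an integer because \<open>U\<^sub>-\<^sub>1 = 0\<close> is needed; the value 0 at
  indices below -1 is a dummy.\<close>

function cheb_U :: "int \<Rightarrow> 'a::comm_ring_1 poly" where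
  "cheb_U r = (if r < 0 then 0 else if r = 0 then 1
               else [:0, 2:] * cheb_U (r - 1) - cheb_U (r - 2))"
  by auto
termination by (relation "measure (\<lambda>r. nat (r + 1))") auto

declare cheb_U.simps [simp del]

lemma cheb_U_minus_1: "cheb_U (-1) = 0"
  and cheb_U_0: "cheb_U 0 = 1"
  and cheb_U_1: "cheb_U 1 = [:0, 2:]"
  and cheb_U_rec: "r \<ge> 1 \<Longrightarrow> cheb_U r = [:0, 2:] * cheb_U (r - 1) - cheb_U (r - 2)"
  by (simp_all add: cheb_U.simps)

lemma cheb_U_cos:
  fixes \<theta> :: real
  assumes "r \<ge> -1"
  shows "poly (cheb_U r) (cos \<theta>) * sin \<theta> = sin ((of_int r + 1) * \<theta>)"
  using assms
proof (induction r rule: cheb_U.induct)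
  case (1 r)
  consider "r = -1" | "r = 0" | "r \<ge> 1" using "1.prems" by linarith
  then show ?case
  proof cases
    case 3
    have a: "poly (cheb_U (r - 1)) (cos \<theta>) * sin \<theta> = sin (of_int r * \<theta>)"
      using "1.IH"(1) 3 by simp
    have b: "poly (cheb_U (r - 2)) (cos \<theta>) * sin \<theta> = sin (of_int r * \<theta> - \<theta>)"
      using "1.IH"(2) 3 by (simp add: algebra_simps)
    have "poly (cheb_U r) (cos \<theta>) * sin \<theta> =
        2 * cos \<theta> * (poly (cheb_U (r - 1)) (cos \<theta>) * sin \<theta>) -
        poly (cheb_U (r - 2)) (cos \<theta>) * sin \<theta>"
      by (subst cheb_U_rec[OF 3]) (simp add: algebra_simps)
    also have "\<dots> = sin (of_int r * \<theta> + \<theta>)"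
      by (simp add: a b sin_add sin_diff)
    finally show ?thesis by (simp add: algebra_simps)
  qed (simp_all add: cheb_U_minus_1 cheb_U_0)
qed

text \<open>\<open>U\<^sub>r(1/(2x))\<close> in the field of formal Laurent series in \<open>x\<close>.\<close>

definition cheb_U_at :: "int \<Rightarrow> real fls" where
  "cheb_U_at r = poly (cheb_U r) (1 / (2 * fls_X))"

lemma cheb_U_at_rec:
  assumes "r \<ge> 1"
  shows "fls_X * cheb_U_at r = cheb_U_at (r - 1) - fls_X * cheb_U_at (r - 2)"
proof -
  have "cheb_U_at r = 2 * (1 / (2 * fls_X)) * cheb_U_at (r - 1) - cheb_U_at (r - 2)"
    unfolding cheb_U_at_def
    by (subst cheb_U_rec[OF assms]) (simp only: poly_diff poly_mult poly_pCons poly_0 mult_zero_right mult_zero_left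
      add_0_right add_0_left mult_ac)
  also have "2 * (1 / (2 * fls_X)) = 1 / (fls_X :: real fls)"
    by simp
  finally have "fls_X * cheb_U_at r =
      (fls_X * (1 / fls_X)) * cheb_U_at (r - 1) - fls_X * cheb_U_at (r - 2)"
    by (simp only: right_diff_distrib mult.assoc)
  also have "fls_X * (1 / fls_X) = (1 :: real fls)"
    by (metis divide_self_if fls_X_nonzero mult.right_neutral times_divide_eq_right)
  finally show ?thesis by simp
qed

lemma cheb_U_at_unit_part:
  "\<exists>g. g $ 0 = 1 \<and> fls_X ^ n * cheb_U_at (int n) = fps_to_fls g"
proof (induction n rule: less_induct)
  case (less n)
  consider "n = 0" | "n = 1" | m where "n = Suc (Suc m)"
    by (metis One_nat_def not0_implies_Suc)
  then show ?case
  proof cases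
    case 1
    then show ?thesis
      by (intro exI[of _ 1]) (simp add: cheb_U_at_def cheb_U_0)
  next
    case 2
    then show ?thesis
      using cheb_U_at_rec[of 1]
      by (intro exI[of _ 1]) (simp add: cheb_U_at_def cheb_U_0 cheb_U_minus_1)
  next
    case (3 m)
    obtain g where g: "g $ 0 = 1" "fls_X ^ m * cheb_U_at (int m) = fps_to_fls g"
      using less[of m] 3 by auto
    obtain h where h: "h $ 0 = 1" "fls_X ^ Suc m * cheb_U_at (int (Suc m)) = fps_to_fls h"
      using less[of "Suc m"] 3 by blast
    have "fls_X ^ n * cheb_U_at (int n) = fls_X ^ Suc m * (fls_X * cheb_U_at (int n))"
      by (simp add: 3 algebra_simps)
    also have "fls_X * cheb_U_at (int n) = cheb_U_at (int (Suc m)) - fls_X * cheb_U_at (int m)"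
      using cheb_U_at_rec[of "int n"] by (simp add: 3 algebra_simps)
    also have "fls_X ^ Suc m * (cheb_U_at (int (Suc m)) - fls_X * cheb_U_at (int m)) =
        fls_X ^ Suc m * cheb_U_at (int (Suc m)) - fls_X ^ 2 * (fls_X ^ m * cheb_U_at (int m))"
      by (simp add: algebra_simps power2_eq_square)
    also have "\<dots> = fps_to_fls (h - fps_X ^ 2 * g)"
      unfolding g h
      by (simp add: fps_to_fls_minus fls_times_fps_to_fls fps_to_fls_power)
    finally show ?thesis
      using h(1) by (intro exI[of _ "h - fps_X ^ 2 * g"]) simp
  qed
qed

lemma cheb_U_at_nonzero: "cheb_U_at (int n) \<noteq> 0"
  using cheb_U_at_unit_part[of n] by fastforce

end

theory Submission
  imports Defs "HOL-Library.Sublist"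
begin

text \<open>
  Write a permutation as \<open>u @ n # v\<close>, where \<open>n\<close> is its maximum. It avoids 132 iff \<open>u\<close> and
  \<open>v\<close> do and every entry of \<open>u\<close> exceeds every entry of \<open>v\<close>; a longest increasing subsequence
  is then either one of \<open>u\<close> followed by \<open>n\<close>, or one of \<open>v\<close>. Since \<open>n\<close> is a peak, the first
  step and the parity of \<open>length u\<close> determine each other. Hence, if \<open>A\<^sub>k\<close>, \<open>B\<^sub>k\<close> count
  words of odd and even length beginning with an ascent, \<open>D\<^sub>k\<close>, \<open>C\<^sub>k\<close> those beginning with a
  descent (lengths 0 and 1 included), then for \<open>k \<ge> 2\<close>
  \<open>A\<^sub>k = x + x A\<^sub>k\<^sub>-\<^sub>1 A\<^sub>k\<close>, \<open>B\<^sub>k = 1 + x A\<^sub>k\<^sub>-\<^sub>1 B\<^sub>k\<close>,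
  \<open>C\<^sub>k = 1 + x C\<^sub>k\<^sub>-\<^sub>1 A\<^sub>k\<close> and \<open>D\<^sub>k = x C\<^sub>k\<^sub>-\<^sub>1 B\<^sub>k\<close>, with \<open>A\<^sub>1 = 0\<close> and
  \<open>C\<^sub>1 = 1\<close>. The Chebyshev recurrence gives the solution
  \<open>A\<^sub>k = U\<^sub>k\<^sub>-\<^sub>2 / U\<^sub>k\<^sub>-\<^sub>1\<close>, \<open>x C\<^sub>k = (U\<^sub>k\<^sub>-\<^sub>2 + x\<^sup>k) / U\<^sub>k\<^sub>-\<^sub>1\<close>,
  \<open>A\<^sub>k = x B\<^sub>k\<close>, \<open>C\<^sub>k = 1 + x D\<^sub>k\<close>.
\<close>

section \<open>Pattern avoidance in terms of subsequences\<close>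

lemma subseq_map_iff: "subseq ys (map f xs) \<longleftrightarrow> (\<exists>zs. subseq zs xs \<and> ys = map f zs)"
  by (auto simp: subseq_conv_nths nths_map)

lemma subseq_imp_set_subset: "subseq xs ys \<Longrightarrow> set xs \<subseteq> set ys"
  by (auto simp: subseq_conv_nths dest: in_set_nthsD)

lemma sorted_wrt_subseq:
  assumes "subseq xs ys" "sorted_wrt P ys"
  shows "sorted_wrt P xs"
  using assms
proof (induction rule: list_emb.induct)
  case (list_emb_Cons2 x y xs ys)
  then show ?case using subseq_imp_set_subset by fastforce
qed auto

text \<open>The bridge from index lists to \<open>subseq\<close>: admissible index lists are exactly
  the subsequences of \<open>[0..<length xs]\<close>.\<close>

lemma subseq_conv_indices:
  "subseq ys xs \<longleftrightarrow>
    (\<exists>is. sorted_wrt (<) is \<and> set is \<subseteq> {..<length xs} \<and> ys = map (\<lambda>i. xs ! i) is)"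
proof -
  have "subseq is [0..<length xs] \<longleftrightarrow> sorted_wrt (<) is \<and> set is \<subseteq> {..<length xs}" for "is"
  proof
    assume "subseq is [0..<length xs]"
    then show "sorted_wrt (<) is \<and> set is \<subseteq> {..<length xs}"
      using sorted_wrt_subseq[of "is" "[0..<length xs]" "(<)"]
        subseq_imp_set_subset[of "is" "[0..<length xs]"] by auto
  next
    assume "sorted_wrt (<) is \<and> set is \<subseteq> {..<length xs}"
    then show "subseq is [0..<length xs]"
      by (intro sorted_subset_imp_subseq) (auto simp: lessThan_atLeast0)
  qed
  then show ?thesis
    using subseq_map_iff[of ys "\<lambda>i. xs ! i" "[0..<length xs]"] by (simp add: map_nth)
qed

lemma avoids_iff_subseq: "avoids \<pi> \<tau> \<longleftrightarrow> (\<forall>ys. subseq ys \<pi> \<longrightarrow> \<not> order_isomorphic ys \<tau>)"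
  unfolding avoids_def occurs_at_def subseq_conv_indices by blast

definition avoids_132 :: "'a::linorder list \<Rightarrow> bool" where
  "avoids_132 xs \<longleftrightarrow> (\<forall>a b c. subseq [a, b, c] xs \<longrightarrow> \<not> (a < c \<and> c < b))"

text \<open>Bounding every increasing length, instead of forbidding one exact length, suits removal
  of the maximum. At \<open>k = 0\<close> even the empty subsequence breaks the bound, so no word
  qualifies.\<close>

definition increasing_below :: "nat \<Rightarrow> 'a::linorder list \<Rightarrow> bool" where
  "increasing_below k xs \<longleftrightarrow> (\<forall>ys. subseq ys xs \<longrightarrow> sorted_wrt (<) ys \<longrightarrow> length ys < k)"

lemma order_isomorphic_132_iff:
  "order_isomorphic ys [1, 3, 2] \<longleftrightarrow> (\<exists>a b c. ys = [a, b, c] \<and> a < c \<and> c < b)"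
proof
  assume iso: "order_isomorphic ys [1, 3, 2]"
  then have "length ys = 3" by (simp add: order_isomorphic_def)
  then obtain a b c where ys: "ys = [a, b, c]"
    by (auto simp: numeral_3_eq_3 length_Suc_conv)
  have "ys ! 0 < ys ! 2 \<longleftrightarrow> [1, 3, 2 :: nat] ! 0 < [1, 3, 2] ! 2"
    "ys ! 2 < ys ! 1 \<longleftrightarrow> [1, 3, 2 :: nat] ! 2 < [1, 3, 2] ! 1"
    using iso \<open>length ys = 3\<close> unfolding order_isomorphic_def by simp_all
  then show "\<exists>a b c. ys = [a, b, c] \<and> a < c \<and> c < b"
    by (simp add: ys)
next
  assume "\<exists>a b c. ys = [a, b, c] \<and> a < c \<and> c < b"
  then show "order_isomorphic ys [1, 3, 2]"
    by (auto simp: order_isomorphic_def less_Suc_eq)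
qed

lemma order_isomorphic_increasing_iff:
  "order_isomorphic ys [1..<Suc k] \<longleftrightarrow> length ys = k \<and> sorted_wrt (<) ys"
proof
  assume "order_isomorphic ys [1..<Suc k]"
  then show "length ys = k \<and> sorted_wrt (<) ys"
    by (auto simp: order_isomorphic_def sorted_wrt_iff_nth_less simp del: upt_Suc)
next
  assume *: "length ys = k \<and> sorted_wrt (<) ys"
  then have "ys ! i < ys ! j \<longleftrightarrow> i < j" if "i < k" "j < k" for i j
    using that by (metis linorder_neqE_nat order_less_asym order_less_irrefl sorted_wrt_iff_nth_less)
  with * show "order_isomorphic ys [1..<Suc k]"
    by (auto simp: order_isomorphic_def simp del: upt_Suc)
qed

lemma avoids_132_iff: "avoids \<pi> [1, 3, 2] \<longleftrightarrow> avoids_132 \<pi>"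
  unfolding avoids_iff_subseq order_isomorphic_132_iff avoids_132_def by blast

lemma avoids_increasing_iff: "avoids \<pi> [1..<Suc k] \<longleftrightarrow> increasing_below k \<pi>"
proof -
  \<comment> \<open>A too long increasing subsequence is truncated to length exactly
    \<open>k\<close>.\<close>
  have "\<exists>zs. subseq zs \<pi> \<and> length zs = k \<and> sorted_wrt (<) zs"
    if "subseq ys \<pi>" "sorted_wrt (<) ys" "k \<le> length ys" for ys
  proof (intro exI conjI)
    show "subseq (take k ys) \<pi>"
      using that(1) by (meson prefix_imp_subseq subseq_order.order_trans take_is_prefix)
    show "sorted_wrt (<) (take k ys)"
      using that(2) by (rule sorted_wrt_take)
  qed (use that in simp)
  then show ?thesis
    unfolding avoids_iff_subseq order_isomorphic_increasing_iff increasing_below_def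
    using leI less_irrefl by blast
qed

lemma avoids_132_map_strict_mono:
  assumes "strict_mono f"
  shows "avoids_132 (map f xs) \<longleftrightarrow> avoids_132 xs"
proof -
  have "subseq [a, b, c] (map f xs) \<longleftrightarrow>
      (\<exists>a' b' c'. subseq [a', b', c'] xs \<and> a = f a' \<and> b = f b' \<and> c = f c')" for a b c
    unfolding subseq_map_iff by (auto simp: Cons_eq_map_conv)
  then show ?thesis
    using strict_mono_less[OF assms] unfolding avoids_132_def by metis
qed

lemma increasing_below_map_strict_mono:
  assumes "strict_mono f"
  shows "increasing_below k (map f xs) \<longleftrightarrow> increasing_below k xs"
  unfolding increasing_below_def subseq_map_iff
  by (auto simp: sorted_wrt_map strict_mono_less[OF assms])

section \<open>Patterns in a word split at its maximum\<close>

text \<open>Letters may repeat here, hence the weak inequality: only \<open>x < y\<close> makes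
  \<open>x\<close>, \<open>m\<close>, \<open>y\<close> a 132.\<close>

lemma avoids_132_split_max:
  assumes "\<And>x. x \<in> set (u @ v) \<Longrightarrow> x < m"
  shows "avoids_132 (u @ m # v) \<longleftrightarrow>
    avoids_132 u \<and> avoids_132 v \<and> (\<forall>x\<in>set u. \<forall>y\<in>set v. y \<le> x)"
proof (intro iffI conjI ballI)
  assume av: "avoids_132 (u @ m # v)"
  show "avoids_132 u" "avoids_132 v"
    using av unfolding avoids_132_def
    by (meson list_emb_Cons subseq_drop_many subseq_rev_drop_many)+
  fix x y assume "x \<in> set u" "y \<in> set v"
  then have "subseq ([x] @ [m, y]) (u @ m # v)"
    by (intro list_emb_append_mono) (simp_all add: subseq_singleton_left)
  then show "y \<le> x"
    using av assms[of y] \<open>y \<in> set v\<close> unfolding avoids_132_def by force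
next
  assume *: "avoids_132 u \<and> avoids_132 v \<and> (\<forall>x\<in>set u. \<forall>y\<in>set v. y \<le> x)"
  show "avoids_132 (u @ m # v)"
    unfolding avoids_132_def
  proof (intro allI impI notI)
    fix a b c assume "subseq [a, b, c] (u @ m # v)" and abc: "a < c \<and> c < b"
    \<comment> \<open>The occurrence is cut where \<open>u\<close> ends; the cases are how many of
      its letters lie in \<open>u\<close>.\<close>
    then obtain p q where pq: "[a, b, c] = p @ q" "subseq p u" "subseq q (m # v)"
      by (metis subseq_appendE)
    have p: "set p \<subseteq> set u" and q: "set q \<subseteq> insert m (set v)"
      using pq(2,3)[THEN subseq_imp_set_subset] by auto
    have "p = [] \<and> q = [a, b, c] \<or> p = [a] \<and> q = [b, c] \<or> p = [a, b] \<and> q = [c] \<or> p = [a, b, c]"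
      using pq(1)[symmetric] unfolding append_eq_Cons_conv by auto
    then consider "p = []" "q = [a, b, c]" | "p = [a]" "q = [b, c]" | "p = [a, b]" "q = [c]" | "p = [a, b, c]"
      by blast
    then show False
    proof cases
      case 1
      have "a \<noteq> m"
        using 1 q abc assms by (auto dest: less_asym)
      then have "subseq [a, b, c] v" using 1 pq(3) by (simp split: if_splits)
      then show False using * abc by (auto simp: avoids_132_def)
    next
      case 2
      then have "a \<in> set u" "c \<in> insert m (set v)" using p q by auto
      moreover have "c \<noteq> m"
        using 2 q abc assms by (auto dest: less_asym)
      ultimately show False using * abc by force
    next
      case 3
      then have "a \<in> set u" "b \<in> set u" "c \<in> insert m (set v)" using p q by auto
      moreover from this have "c \<noteq> m" using abc assms[of b] by (auto dest: less_asym)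
      ultimately show False using * abc by force
    next
      case 4
      then show False using * abc pq(2) by (auto simp: avoids_132_def)
    qed
  qed
qed

lemma increasing_below_split_max:
  assumes m: "\<And>x. x \<in> set (u @ v) \<Longrightarrow> x < m"
    and uv: "\<And>x y. x \<in> set u \<Longrightarrow> y \<in> set v \<Longrightarrow> y \<le> x"
  shows "increasing_below (Suc k) (u @ m # v) \<longleftrightarrow>
    increasing_below k u \<and> increasing_below (Suc k) v"
proof (intro iffI conjI)
  assume inc: "increasing_below (Suc k) (u @ m # v)"
  show "increasing_below (Suc k) v"
    using inc unfolding increasing_below_def
    by (meson list_emb_Cons subseq_drop_many)
  show "increasing_below k u"
    unfolding increasing_below_def
  proof (intro allI impI)
    fix ys assume ys: "subseq ys u" "sorted_wrt (<) ys"
    \<comment> \<open>Appending \<open>m\<close> adds one letter: this is why \<open>u\<close> gets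
      the bound \<open>k\<close> while \<open>v\<close> keeps \<open>Suc k\<close>.\<close>
    have "subseq (ys @ [m]) (u @ m # v)"
      using ys(1) by (intro list_emb_append_mono) auto
    moreover have "sorted_wrt (<) (ys @ [m])"
      using ys(2) m subseq_imp_set_subset[OF ys(1)] by (auto simp: sorted_wrt_append)
    ultimately have "length (ys @ [m]) < Suc k"
      using inc unfolding increasing_below_def by blast
    then show "length ys < k" by simp
  qed
next
  assume *: "increasing_below k u \<and> increasing_below (Suc k) v"
  show "increasing_below (Suc k) (u @ m # v)"
    unfolding increasing_below_def
  proof (intro allI impI)
    fix ys assume "subseq ys (u @ m # v)" and sorted: "sorted_wrt (<) ys"
    then obtain p q where pq: "ys = p @ q" "subseq p u" "subseq q (m # v)"
      by (metis subseq_appendE)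
    have p: "set p \<subseteq> set u" using pq(2) by (rule subseq_imp_set_subset)
    have sp: "sorted_wrt (<) p" "sorted_wrt (<) q" and pq_less: "\<forall>x\<in>set p. \<forall>y\<in>set q. x < y"
      using sorted by (auto simp: pq(1) sorted_wrt_append)
    have len_p: "length p < k" using * pq(2) sp(1) by (auto simp: increasing_below_def)
    show "length ys < Suc k"
    proof (cases "\<exists>r. q = m # r")
      case True
      then obtain r where r: "q = m # r" by blast
      then have "subseq r v" using pq(3) by simp
      then have "set r \<subseteq> set v" by (rule subseq_imp_set_subset)
      \<comment> \<open>Nothing larger than \<open>m\<close> can follow it.\<close>
      then have "r = []" using sp(2) r m
        by (cases r) (auto dest: less_asym)
      then show ?thesis using len_p r pq(1) by simp
    next
      case False
      then have q: "subseq q v" using pq(3) by (cases q) (auto split: if_splits)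
      then have "set q \<subseteq> set v" by (rule subseq_imp_set_subset)
      \<comment> \<open>A letter from each block would give \<open>x < y\<close> against
        \<open>y \<le> x\<close>.\<close>
      then have "p = [] \<or> q = []"
        using p pq_less uv by (cases p; cases q) (auto simp: not_less[symmetric])
      then show ?thesis
        using len_p q sp(2) * pq(1) by (auto simp: increasing_below_def)
    qed
  qed
qed

lemma avoids_132_Nil [simp]: "avoids_132 []"
  by (simp add: avoids_132_def)

lemma increasing_below_Nil [simp]: "increasing_below k [] \<longleftrightarrow> k > 0"
  unfolding increasing_below_def by (auto dest: list_emb_length)

section \<open>Alternating words\<close>

text \<open>The decomposition has empty and one-letter blocks, so words this short count for both
  flags, unlike in \<open>up_down\<close> and its companions.\<close>

fun alternating :: "bool \<Rightarrow> 'a::linorder list \<Rightarrow> bool" where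
  "alternating b (x # y # xs) \<longleftrightarrow> (if b then x < y else y < x) \<and> alternating (\<not> b) (y # xs)"
| "alternating b _ \<longleftrightarrow> True"

lemma alternating_iff_nth:
  "alternating b xs \<longleftrightarrow> (\<forall>i. Suc i < length xs \<longrightarrow>
     (if even i = b then xs ! i < xs ! Suc i else xs ! Suc i < xs ! i))"
proof (induction b xs rule: alternating.induct)
  case (1 b x y xs)
  have "(\<forall>i. P i) \<longleftrightarrow> P 0 \<and> (\<forall>i. P (Suc i))" for P :: "nat \<Rightarrow> bool"
    by (metis not0_implies_Suc)
  from this[of "\<lambda>i. Suc i < length (x # y # xs) \<longrightarrow> (if even i = b
      then (x # y # xs) ! i < (x # y # xs) ! Suc i else (x # y # xs) ! Suc i < (x # y # xs) ! i)"]
  show ?case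
    unfolding alternating.simps 1 by (cases b) auto
qed auto

lemma alternating_from_up_iff: "alternating_from_up \<pi> \<longleftrightarrow> alternating True \<pi>"
  unfolding alternating_from_up_def alternating_iff_nth by simp

lemma alternating_from_down_iff: "alternating_from_down \<pi> \<longleftrightarrow> alternating False \<pi>"
  unfolding alternating_from_down_def alternating_iff_nth by auto

lemma alternating_map_strict_mono:
  assumes "strict_mono f"
  shows "alternating b (map f xs) \<longleftrightarrow> alternating b xs"
  by (induction b xs rule: alternating.induct) (auto simp: strict_mono_less[OF assms])

text \<open>The step into \<open>m\<close> is an ascent and the step out of it a descent; either
  one, if present, forces the parity of \<open>length u\<close>. With \<open>u\<close> and
  \<open>v\<close> both empty neither exists, hence the exception.\<close>

lemma alternating_split_max:
  assumes "\<And>x. x \<in> set (u @ v) \<Longrightarrow> x < m"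
  shows "alternating b (u @ m # v) \<longleftrightarrow> alternating b u \<and> alternating True v \<and>
    (u = [] \<and> v = [] \<or> odd (length u) = b)"
  using assms
proof (induction b u rule: alternating.induct)
  case ("2_1" b)
  then show ?case by (cases v) (auto dest: less_asym)
next
  case ("2_2" b x)
  then show ?case by (cases v) (auto dest: less_asym)
qed auto

section \<open>Removing the maximum\<close>

text \<open>The letter set is a parameter because the block left of the maximum uses a top interval
  of the letters.\<close>

definition alt_avoiders :: "bool \<Rightarrow> nat \<Rightarrow> nat set \<Rightarrow> nat list set" where
  "alt_avoiders b k S =
    {\<pi> \<in> permutations_of_set S. avoids_132 \<pi> \<and> increasing_below k \<pi> \<and> alternating b \<pi>}"

definition num_alt :: "bool \<Rightarrow> nat \<Rightarrow> nat \<Rightarrow> nat" where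
  "num_alt b k n = card (alt_avoiders b k {1..n})"

lemma finite_alt_avoiders [simp]: "finite (alt_avoiders b k S)"
  by (simp add: alt_avoiders_def)

lemma card_alt_avoiders_shift: "card (alt_avoiders b k {a+1..a+n}) = num_alt b k n"
proof -
  let ?f = "\<lambda>x::nat. x + a"
  have mono: "strict_mono ?f" by (simp add: strict_mono_def)
  have "{a+1..a+n} = ?f ` {1..n}" by (simp add: add.commute)
  also have "alt_avoiders b k \<dots> = map ?f ` alt_avoiders b k {1..n}"
    unfolding alt_avoiders_def
    by (subst permutations_of_set_image_inj)
      (auto simp: avoids_132_map_strict_mono[OF mono] increasing_below_map_strict_mono[OF mono]
        alternating_map_strict_mono[OF mono])
  finally show ?thesis
    unfolding num_alt_def by (simp add: card_image inj_mapI inj_on_subset[OF inj_mapI])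
qed

lemma num_alt_0: "num_alt b k 0 = (if k = 0 then 0 else 1)"
proof -
  have "alt_avoiders b k {1..0} = (if k = 0 then {} else {[]})"
    by (auto simp: alt_avoiders_def)
  then show ?thesis by (simp add: num_alt_def)
qed

text \<open>Nothing below \<open>Max B\<close> can lie in \<open>A\<close>, so \<open>B\<close> is
  an initial segment. This fixes the letters of both blocks from the length of one.\<close>

lemma lower_set_eq_atLeastAtMost:
  fixes A B :: "nat set"
  assumes un: "A \<union> B = {1..n}" and less: "\<And>a b. a \<in> A \<Longrightarrow> b \<in> B \<Longrightarrow> b < a"
  shows "B = {1..card B} \<and> A = {card B+1..n}"
proof -
  have "\<exists>m\<le>n. B = {1..m}"
  proof (cases "B = {}")
    case False
    have fin: "finite B" using un by (metis finite_Un finite_atLeastAtMost)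
    have "B = {1..Max B}"
    proof (intro equalityI subsetI)
      fix x assume "x \<in> {1..Max B}"
      moreover have "Max B \<in> B" using fin False by simp
      moreover from this have "Max B \<le> n" using un by (metis UnI2 atLeastAtMost_iff)
      ultimately have "x \<in> A \<union> B" "x \<notin> A" using less[of x "Max B"] unfolding un by auto
      then show "x \<in> B" by blast
    qed (use un fin in auto)
    moreover have "Max B \<le> n" using fin False un Max_in by fastforce
    ultimately show ?thesis by blast
  qed auto
  then obtain m where m: "m \<le> n" "B = {1..m}" by blast
  have "A = {m+1..n}"
  proof (intro equalityI subsetI)
    fix x assume x: "x \<in> A"
    then have "x \<in> {1..n}" "x \<notin> B" using un less by auto
    then show "x \<in> {m+1..n}" using m by auto
  next
    fix x assume "x \<in> {m+1..n}"
    then have "x \<in> A \<union> B" "x \<notin> B" using un m by auto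
    then show "x \<in> A" by blast
  qed
  with m show ?thesis by simp
qed

text \<open>Here \<open>i\<close> is the length of the left block, whose interval is written as a
  shift by \<open>n-i\<close> to match \<open>card_alt_avoiders_shift\<close>. The guard
  \<open>n = 0\<close> admits the one-letter word, on which parity imposes nothing.\<close>

lemma alt_avoiders_Suc:
  "alt_avoiders b (Suc k) {1..Suc n} =
    (\<Union>i\<in>{..n}. if odd i = b \<or> n = 0 then (\<lambda>(u, v). u @ Suc n # v) `
      (alt_avoiders b k {(n-i)+1..(n-i)+i} \<times> alt_avoiders True (Suc k) {1..n-i}) else {})"
  (is "?L = ?R")
proof (intro equalityI subsetI)
  fix \<pi> assume pi: "\<pi> \<in> ?L"
  then have set_pi: "set \<pi> = {1..Suc n}" and dist: "distinct \<pi>"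
    by (auto simp: alt_avoiders_def dest: permutations_of_setD)
  then obtain u v where uv: "\<pi> = u @ Suc n # v"
    using split_list[of "Suc n" \<pi>] by auto
  have "set u \<union> set v = set \<pi> - {Suc n}" using dist by (auto simp: uv)
  then have un: "set u \<union> set v = {1..n}" by (simp add: set_pi atLeastAtMostSuc_conv)
  then have m: "x < Suc n" if "x \<in> set (u @ v)" for x
    using that by (metis atLeastAtMost_iff le_imp_less_Suc set_append)
  have av: "avoids_132 u" "avoids_132 v" and le: "\<And>x y. x \<in> set u \<Longrightarrow> y \<in> set v \<Longrightarrow> y \<le> x"
    using pi avoids_132_split_max[OF m] by (auto simp: alt_avoiders_def uv)
  have inc: "increasing_below k u" "increasing_below (Suc k) v"
    using pi increasing_below_split_max[OF m le] by (auto simp: alt_avoiders_def uv)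
  have alt: "alternating b u" "alternating True v" "u = [] \<and> v = [] \<or> odd (length u) = b"
    using pi alternating_split_max[OF m] by (auto simp: alt_avoiders_def uv)
  \<comment> \<open>Distinctness makes the inequality strict, as the interval lemma
    requires.\<close>
  have "y < x" if "x \<in> set u" "y \<in> set v" for x y
    using le[OF that] dist that by (force simp: uv order_le_less)
  from lower_set_eq_atLeastAtMost[OF un this]
  have sets: "set v = {1..length v}" "set u = {length v+1..n}"
    using dist by (simp_all add: uv distinct_card)
  have len: "length u + length v = n"
    using dist set_pi distinct_card[OF dist] by (simp add: uv)
  then have lv: "length v = n - length u" by simp
  have "u \<in> alt_avoiders b k {(n - length u)+1..(n - length u)+length u}"
    using dist sets av inc alt len lv by (simp add: alt_avoiders_def permutations_of_set_def uv)
  moreover have "v \<in> alt_avoiders True (Suc k) {1..n - length u}"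
    using dist sets av inc alt len lv by (simp add: alt_avoiders_def permutations_of_set_def uv)
  moreover have "odd (length u) = b \<or> n = 0" using alt(3) len by auto
  moreover have "length u \<in> {..n}" using len by simp
  ultimately show "\<pi> \<in> ?R" unfolding uv by (intro UN_I[of "length u"]) auto
next
  fix \<pi> assume "\<pi> \<in> ?R"
  then obtain i u v where i: "i \<le> n" "odd i = b \<or> n = 0"
    and u: "u \<in> alt_avoiders b k {(n-i)+1..(n-i)+i}"
    and v: "v \<in> alt_avoiders True (Suc k) {1..n-i}" and uv: "\<pi> = u @ Suc n # v"
    by (auto split: if_splits)
  have sets: "set u = {(n-i)+1..n}" "set v = {1..n-i}" and dist: "distinct u" "distinct v"
    using u v i by (auto simp: alt_avoiders_def permutations_of_set_def)
  have len: "length u = i" "length v = n - i"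
    using distinct_card[OF dist(1)] distinct_card[OF dist(2)] i by (simp_all add: sets)
  have m: "x < Suc n" if "x \<in> set (u @ v)" for x using that by (auto simp: sets)
  have le: "y \<le> x" if "x \<in> set u" "y \<in> set v" for x y using that by (auto simp: sets)
  have "set \<pi> = {1..Suc n}" "distinct \<pi>" using i dist by (auto simp: uv sets)
  moreover have "avoids_132 \<pi>"
    using u v le avoids_132_split_max[OF m] by (auto simp: alt_avoiders_def uv)
  moreover have "increasing_below (Suc k) \<pi>"
    using u v increasing_below_split_max[OF m le] by (auto simp: alt_avoiders_def uv)
  moreover have "alternating b \<pi>"
    using u v i len alternating_split_max[OF m] by (auto simp: alt_avoiders_def uv)
  ultimately show "\<pi> \<in> ?L" by (simp add: alt_avoiders_def permutations_of_set_def)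
qed

text \<open>The letter \<open>Suc n\<close> occurs only once, so its position recovers both blocks:
  the union is disjoint and each concatenation map injective.\<close>

lemma num_alt_Suc:
  "num_alt b (Suc k) (Suc n) =
    (\<Sum>i\<le>n. if odd i = b \<or> n = 0 then num_alt b k i * num_alt True (Suc k) (n - i) else 0)"
proof -
  let ?g = "\<lambda>(u, v). u @ Suc n # v"
  let ?P = "\<lambda>i. alt_avoiders b k {(n-i)+1..(n-i)+i} \<times> alt_avoiders True (Suc k) {1..n-i}"
  have P: "Suc n \<notin> set u" "Suc n \<notin> set v" "length u = i"
    if "(u, v) \<in> ?P i" "i \<le> n" for i u v
  proof -
    have s: "set u = {(n-i)+1..n}" "set v = {1..n-i}" "distinct u"
      using that by (auto simp: alt_avoiders_def permutations_of_set_def)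
    then show "Suc n \<notin> set u" "Suc n \<notin> set v" by auto
    show "length u = i" using distinct_card[OF s(3)] that by (simp add: s)
  qed
  have eq: "u = u' \<and> v = v'"
    if "(u, v) \<in> ?P i" "(u', v') \<in> ?P j" "i \<le> n" "j \<le> n" "u @ Suc n # v = u' @ Suc n # v'"
    for i j u v u' v'
    using P[OF that(1,3)] that(5) by (simp add: append_Cons_eq_iff)
  have disj: "?g ` ?P i \<inter> ?g ` ?P j = {}" if "i \<le> n" "j \<le> n" "i \<noteq> j" for i j
  proof (rule ccontr)
    assume "?g ` ?P i \<inter> ?g ` ?P j \<noteq> {}"
    then obtain u v u' v' where *: "(u, v) \<in> ?P i" "(u', v') \<in> ?P j" "?g (u, v) = ?g (u', v')"
      by blast
    then have "u = u'" using eq[OF *(1,2) that(1,2)] by simp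
    then show False using P(3)[OF *(1) that(1)] P(3)[OF *(2) that(2)] that(3) by simp
  qed
  have inj: "inj_on ?g (?P i)" if "i \<le> n" for i
    using eq[OF _ _ that that] by (intro inj_onI) auto
  have "num_alt b (Suc k) (Suc n) =
      (\<Sum>i\<le>n. card (if odd i = b \<or> n = 0 then ?g ` ?P i else {}))"
    unfolding num_alt_def alt_avoiders_Suc
  proof (rule card_UN_disjoint)
    show "\<forall>i\<in>{..n}. \<forall>j\<in>{..n}. i \<noteq> j \<longrightarrow>
        (if odd i = b \<or> n = 0 then ?g ` ?P i else {}) \<inter>
        (if odd j = b \<or> n = 0 then ?g ` ?P j else {}) = {}"
      using disj by (intro ballI impI) (simp only: atMost_iff split: if_split, blast)
  qed auto
  also have "\<dots> = (\<Sum>i\<le>n. if odd i = b \<or> n = 0 then num_alt b k i * num_alt True (Suc k) (n - i) else 0)"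
  proof (rule sum.cong[OF refl])
    fix i assume "i \<in> {..n}"
    then have "card (?g ` ?P i) = num_alt b k i * num_alt True (Suc k) (n - i)"
      using inj[of i] card_alt_avoiders_shift[of b k "n-i" i]
      by (simp add: card_image card_cartesian_product num_alt_def)
    then show "card (if odd i = b \<or> n = 0 then ?g ` ?P i else {}) =
        (if odd i = b \<or> n = 0 then num_alt b k i * num_alt True (Suc k) (n - i) else 0)"
      by simp
  qed
  finally show ?thesis .
qed

section \<open>Generating functions\<close>

text \<open>The factor \<open>fls_X\<close> stands for the maximum; \<open>e\<close> is for a
  one-letter word that the convolution misses.\<close>

lemma gen_fun_convolution:
  assumes "\<And>n. c (Suc n) = (if n = 0 then e else 0) + (\<Sum>i\<le>n. a i * b (n - i))"
  shows "gen_fun c = of_nat (c 0) + fls_X * (of_nat e + gen_fun a * gen_fun b)"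
proof -
  let ?F = "\<lambda>f. Abs_fps (\<lambda>n. real (f n))"
  have ab: "(?F a * ?F b) $ n = (\<Sum>i\<le>n. real (a i) * real (b (n - i)))" for n
    by (simp add: fps_mult_nth atLeast0AtMost)
  have "?F c = of_nat (c 0) + fps_X * (of_nat e + ?F a * ?F b)"
  proof (rule fps_ext)
    fix n
    show "?F c $ n = (of_nat (c 0) + fps_X * (of_nat e + ?F a * ?F b)) $ n"
      by (cases n) (simp_all add: assms ab flip: fps_of_nat)
  qed
  then show ?thesis
    unfolding gen_fun_def
    by (simp add: fls_times_fps_to_fls flip: fps_to_fls_of_nat)
qed

text \<open>\<open>parity_part p b k\<close> restricts \<open>num_alt b k\<close> to odd lengths if \<open>p\<close> holds and to
  even lengths otherwise.\<close>

definition parity_part :: "bool \<Rightarrow> bool \<Rightarrow> nat \<Rightarrow> nat \<Rightarrow> nat" where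
  "parity_part p b k n = (if odd n = p then num_alt b k n else 0)"

text \<open>From \<open>Suc n = i + 1 + (n - i)\<close> and \<open>odd i = b\<close>, a word of
  parity \<open>p\<close> has a right block of odd length iff \<open>p = b\<close>. The one-letter
  word has an empty left block, of the wrong parity when \<open>b\<close> holds; hence the extra
  term, for \<open>k > 0\<close> only since bound 1 excludes that word.\<close>

lemma parity_part_Suc:
  "parity_part p b (Suc k) (Suc n) = (if n = 0 then if p \<and> b \<and> k > 0 then 1 else 0 else 0) +
    (\<Sum>i\<le>n. parity_part b b k i * parity_part (p = b) True (Suc k) (n - i))"
proof (cases "n = 0")
  case True
  then show ?thesis by (cases p; cases b) (simp_all add: parity_part_def num_alt_Suc num_alt_0)
next
  case False
  show ?thesis
  proof (cases "odd (Suc n) = p")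
    case True
    with False show ?thesis
      by (auto simp: parity_part_def num_alt_Suc intro!: sum.cong)
  next
    case False
    \<comment> \<open>For the wrong total parity, one factor of each product vanishes.\<close>
    have "parity_part b b k i * parity_part (p = b) True (Suc k) (n - i) = 0" if "i \<le> n" for i
      using that False by (auto simp: parity_part_def)
    then show ?thesis using False \<open>n \<noteq> 0\<close> by (simp add: parity_part_def)
  qed
qed

text \<open>In the notation of the overview, the flags \<open>True True\<close>,
  \<open>False True\<close>, \<open>False False\<close>, \<open>True False\<close> give
  \<open>A\<close>, \<open>B\<close>, \<open>C\<close>, \<open>D\<close>.\<close>

abbreviation parity_gf :: "bool \<Rightarrow> bool \<Rightarrow> nat \<Rightarrow> real fls" where
  "parity_gf p b k \<equiv> gen_fun (parity_part p b k)"

lemma parity_gf_Suc: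
  "parity_gf p b (Suc k) = (if p then 0 else 1) +
    fls_X * ((if p \<and> b \<and> k > 0 then 1 else 0) + parity_gf b b k * parity_gf (p = b) True (Suc k))"
proof -
  have "parity_part p b (Suc k) 0 = (if p then 0 else 1)"
    by (simp add: parity_part_def num_alt_0)
  then show ?thesis
    using gen_fun_convolution[OF parity_part_Suc, of p b k] by (simp split: if_splits)
qed

lemma gen_fun_0: "gen_fun (\<lambda>n. 0) = 0"
  by (simp add: gen_fun_def flip: fps_zero_def)

text \<open>Starting at 0 makes \<open>A\<^sub>1 = 0\<close> and \<open>C\<^sub>1 = 1\<close>
  instances of the general recurrence.\<close>

lemma parity_gf_0: "parity_gf p b 0 = 0"
proof -
  have "parity_part p b 0 n = 0" for n
    by (auto simp: parity_part_def num_alt_def alt_avoiders_def increasing_below_def)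
  then have "parity_part p b 0 = (\<lambda>n. 0)" by (intro ext)
  then show ?thesis by (simp add: gen_fun_0)
qed

section \<open>Solution of the recurrences by Chebyshev polynomials\<close>

text \<open>The recurrence reads \<open>A\<^sub>k (1 - x A\<^sub>k\<^sub>-\<^sub>1) = x\<close>.
  Multiplied by \<open>U\<^sub>k\<^sub>-\<^sub>2\<close>, its left factor becomes
  \<open>x U\<^sub>k\<^sub>-\<^sub>1\<close> by the induction hypothesis and the Chebyshev
  recurrence, and \<open>x\<close> cancels.\<close>

lemma odd_up_gf: "parity_gf True True (Suc j) * cheb_U_at (int j) = cheb_U_at (int j - 1)"
proof (induction j)
  case 0
  show ?case using parity_gf_Suc[of True True 0]
    by (simp add: parity_gf_0 cheb_U_at_def cheb_U_minus_1)
next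
  case (Suc j)
  let ?A = "parity_gf True True"
  have A: "?A (Suc (Suc j)) = fls_X * (1 + ?A (Suc j) * ?A (Suc (Suc j)))"
    using parity_gf_Suc[of True True "Suc j"] by simp
  have U: "fls_X * cheb_U_at (1 + int j) = cheb_U_at (int j) - fls_X * cheb_U_at (int j - 1)"
    using cheb_U_at_rec[of "1 + int j"] by (simp add: algebra_simps)
  have "fls_X * (?A (Suc (Suc j)) * cheb_U_at (1 + int j)) =
      ?A (Suc (Suc j)) * (fls_X * cheb_U_at (1 + int j))"
    by (simp only: mult_ac)
  also have "\<dots> = ?A (Suc (Suc j)) * (cheb_U_at (int j) - fls_X * (?A (Suc j) * cheb_U_at (int j)))"
    unfolding U Suc.IH ..
  also have "\<dots> = (?A (Suc (Suc j)) - fls_X * (?A (Suc j) * ?A (Suc (Suc j)))) * cheb_U_at (int j)"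
    by (simp add: algebra_simps)
  also have "?A (Suc (Suc j)) - fls_X * (?A (Suc j) * ?A (Suc (Suc j))) = fls_X"
    using A by (simp add: algebra_simps)
  finally show ?case by simp
qed

text \<open>After multiplication by the Chebyshev term, \<open>odd_up_gf\<close> lowers its index by
  one and exposes the induction hypothesis; each round adds a factor \<open>fls_X\<close> to the
  power.\<close>

lemma even_down_gf:
  "fls_X * parity_gf False False (Suc j) * cheb_U_at (int j) = cheb_U_at (int j - 1) + fls_X ^ Suc j"
proof (induction j)
  case 0
  show ?case using parity_gf_Suc[of False False 0]
    by (simp add: parity_gf_0 cheb_U_at_def cheb_U_minus_1 cheb_U_0)
next
  case (Suc j)
  let ?A = "parity_gf True True" and ?C = "parity_gf False False"
  have C: "?C (Suc (Suc j)) = 1 + fls_X * (?C (Suc j) * ?A (Suc (Suc j)))"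
    using parity_gf_Suc[of False False "Suc j"] by simp
  have A: "?A (Suc (Suc j)) * cheb_U_at (1 + int j) = cheb_U_at (int j)"
    using odd_up_gf[of "Suc j"] by simp
  have U: "fls_X * cheb_U_at (1 + int j) = cheb_U_at (int j) - fls_X * cheb_U_at (int j - 1)"
    using cheb_U_at_rec[of "1 + int j"] by (simp add: algebra_simps)
  have "fls_X * ?C (Suc (Suc j)) * cheb_U_at (1 + int j) = fls_X * cheb_U_at (1 + int j) +
      fls_X * (fls_X * ?C (Suc j) * (?A (Suc (Suc j)) * cheb_U_at (1 + int j)))"
    by (simp add: C algebra_simps)
  also have "\<dots> = cheb_U_at (int j) + fls_X ^ Suc (Suc j)"
    unfolding A Suc.IH U by (simp add: algebra_simps)
  finally show ?case by simp
qed

text \<open>\<open>A\<close> and \<open>B\<close> solve linear equations with the same factor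
  \<open>?D\<close>, whose inverse is \<open>B\<close>. At \<open>k = 1\<close> the relation fails
  (\<open>A = 0\<close>, \<open>B = 1\<close>), hence the two successors.\<close>

lemma odd_up_gf_eq: "parity_gf True True (Suc (Suc j)) = fls_X * parity_gf False True (Suc (Suc j))"
proof -
  let ?A = "parity_gf True True" and ?B = "parity_gf False True"
  have A: "?A (Suc (Suc j)) = fls_X + fls_X * ?A (Suc j) * ?A (Suc (Suc j))"
    using parity_gf_Suc[of True True "Suc j"] by (simp add: algebra_simps)
  have B: "?B (Suc (Suc j)) = 1 + fls_X * ?A (Suc j) * ?B (Suc (Suc j))"
    using parity_gf_Suc[of False True "Suc j"] by (simp add: algebra_simps)
  let ?D = "1 - fls_X * ?A (Suc j)"
  have "?A (Suc (Suc j)) * ?D = fls_X" "?B (Suc (Suc j)) * ?D = 1"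
    using A B by (simp_all add: algebra_simps)
  then show ?thesis
    by (metis mult.assoc mult.commute mult.right_neutral)
qed

lemma even_down_gf_eq:
  "parity_gf False False (Suc (Suc j)) = 1 + fls_X * parity_gf True False (Suc (Suc j))"
  using parity_gf_Suc[of False False "Suc j"] parity_gf_Suc[of True False "Suc j"] odd_up_gf_eq[of j]
  by (simp add: algebra_simps)

section \<open>Passage to the four classes of the theorem\<close>

lemma gen_fun_add: "gen_fun (\<lambda>n. a n + b n) = gen_fun a + gen_fun b"
proof -
  have "Abs_fps (\<lambda>n. real (a n + b n)) = Abs_fps (\<lambda>n. real (a n)) + Abs_fps (\<lambda>n. real (b n))"
    by (simp add: fps_eq_iff)
  then show ?thesis by (simp add: gen_fun_def fps_to_fls_plus)
qed

lemma gen_fun_delta: "gen_fun (\<lambda>n. if n = m then 1 else 0) = fls_X ^ m"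
proof -
  have "Abs_fps (\<lambda>n. real (if n = m then 1 else 0)) = fps_X ^ m"
    by (simp add: fps_eq_iff)
  then show ?thesis by (simp add: gen_fun_def fps_to_fls_power)
qed

text \<open>The classes of the theorem start at length 2, so each parity loses exactly one word: the
  empty one or the one-letter one, both admissible for \<open>k \<ge> 2\<close>.\<close>

lemma parity_gf_restrict:
  fixes p b :: bool and j :: nat
  defines "c \<equiv> (\<lambda>n. if 2 \<le> n \<and> odd n = p then num_alt b (Suc (Suc j)) n else 0)"
  shows "parity_gf p b (Suc (Suc j)) = gen_fun c + fls_X ^ (if p then 1 else 0)"
proof -
  have one: "num_alt b (Suc (Suc j)) (Suc 0) = 1"
    by (simp add: num_alt_Suc num_alt_0)
  have "parity_part p b (Suc (Suc j)) = (\<lambda>n. c n + (if n = (if p then 1 else 0) then 1 else 0))"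
  proof
    fix n :: nat
    consider "n = 0" | "n = 1" | "n \<ge> 2" by linarith
    then show "parity_part p b (Suc (Suc j)) n = c n + (if n = (if p then 1 else 0) then 1 else 0)"
      by cases (auto simp: parity_part_def c_def one num_alt_0)
  qed
  then show ?thesis by (simp add: gen_fun_add gen_fun_delta)
qed

lemma avoiders_eq: "avoiders k n =
    {\<pi> \<in> permutations_of_set {1..n}. avoids_132 \<pi> \<and> increasing_below k \<pi>}"
  unfolding avoiders_def avoids_132_iff avoids_increasing_iff ..

lemma alternating_class_count:
  assumes "\<And>\<pi>. C \<pi> \<longleftrightarrow> length \<pi> \<ge> 2 \<and> odd (length \<pi>) = p \<and> alternating b \<pi>"
  shows "card {\<pi> \<in> avoiders k n. C \<pi>} = (if 2 \<le> n \<and> odd n = p then num_alt b k n else 0)"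
proof -
  have "length \<pi> = n" if "\<pi> \<in> avoiders k n" for \<pi>
    using that length_finite_permutations_of_set[of \<pi> "{1..n}"] by (simp add: avoiders_def)
  then have "{\<pi> \<in> avoiders k n. C \<pi>} =
      (if 2 \<le> n \<and> odd n = p then alt_avoiders b k {1..n} else {})"
    by (auto simp: assms avoiders_eq alt_avoiders_def)
  then show ?thesis by (auto simp: num_alt_def)
qed

theorem theorem2p4:
  fixes k :: nat
  assumes "k \<ge> 2"
  shows "gen_fun (ud k) = fls_X * cheb_U_at (int k - 3) / cheb_U_at (int k - 1)
    \<and> gen_fun (dd k) = (fls_X ^ (k - 1) + cheb_U_at (int k - 3)) / cheb_U_at (int k - 1)
    \<and> gen_fun (uu k) = cheb_U_at (int k - 3) / cheb_U_at (int k - 1)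
    \<and> gen_fun (du k) = (fls_X ^ (k - 1) + cheb_U_at (int k - 3)) / (fls_X * cheb_U_at (int k - 1)) - fls_X"
proof -
  obtain j where k: "k = Suc (Suc j)"
    using assms by (metis add_2_eq_Suc le_Suc_ex)
  \<comment> \<open>\<open>U\<close>, \<open>W\<close>, \<open>V\<close> have indices
    \<open>k - 1\<close>, \<open>k - 2\<close>, \<open>k - 3\<close>; \<open>rec\<close> serves to
    eliminate the middle one.\<close>
  define U V W where "U = cheb_U_at (1 + int j)" and "V = cheb_U_at (int j - 1)"
    and "W = cheb_U_at (int j)"
  have idx: "cheb_U_at (int k - 1) = U" "cheb_U_at (int k - 3) = V" "k - 1 = Suc j"
    by (simp_all add: k U_def V_def)
  have U0: "U \<noteq> 0" using cheb_U_at_nonzero[of "Suc j"] by (simp add: U_def)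
  have X0: "(fls_X :: real fls) \<noteq> 0" by simp
  have rec: "fls_X * U = W - fls_X * V"
    using cheb_U_at_rec[of "1 + int j"] by (simp add: U_def V_def W_def algebra_simps)
  have ud: "gen_fun (ud k) = parity_gf True True k - fls_X"
    unfolding ud_def k parity_gf_restrict
    by (subst alternating_class_count[where p = True and b = True])
      (simp_all add: up_down_def alternating_from_up_iff)
  have uu: "gen_fun (uu k) = parity_gf False True k - 1"
    unfolding uu_def k parity_gf_restrict
    by (subst alternating_class_count[where p = False and b = True])
      (simp_all add: up_up_def alternating_from_up_iff)
  have du: "gen_fun (du k) = parity_gf True False k - fls_X"
    unfolding du_def k parity_gf_restrict
    by (subst alternating_class_count[where p = True and b = False])
      (simp_all add: down_up_def alternating_from_down_iff)
  have dd: "gen_fun (dd k) = parity_gf False False k - 1"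
    unfolding dd_def k parity_gf_restrict
    by (subst alternating_class_count[where p = False and b = False])
      (simp_all add: down_down_def alternating_from_down_iff)
  have "parity_gf True True k * U = W"
    using odd_up_gf[of "Suc j"] by (simp add: k U_def W_def)
  then have 1: "gen_fun (ud k) * U = fls_X * V"
    unfolding ud using rec by (simp add: algebra_simps)
  have "gen_fun (ud k) = fls_X * gen_fun (uu k)"
    unfolding ud uu using odd_up_gf_eq[of j] by (simp add: k algebra_simps)
  then have 3: "gen_fun (uu k) * U = V"
    using 1 X0 by (simp add: mult.assoc)
  have "fls_X * parity_gf False False k * U = W + fls_X ^ Suc (Suc j)"
    using even_down_gf[of "Suc j"] by (simp add: k U_def W_def)
  \<comment> \<open>Removing the empty word subtracts \<open>fls_X * U\<close>, which by
    \<open>rec\<close> turns \<open>W\<close> into \<open>fls_X * V\<close>; then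
    \<open>fls_X\<close> cancels.\<close>
  then have "fls_X * (gen_fun (dd k) * U) = fls_X * (fls_X ^ Suc j + V)"
    unfolding dd using rec by (simp add: algebra_simps)
  then have 2: "gen_fun (dd k) * U = fls_X ^ Suc j + V"
    using X0 mult_left_cancel by blast
  \<comment> \<open>\<open>du\<close> lacks the one-letter word, so \<open>fls_X\<close> is added
    back; it becomes the final \<open>- fls_X\<close> of the claim.\<close>
  have "gen_fun (dd k) = fls_X * (gen_fun (du k) + fls_X)"
    unfolding dd du using even_down_gf_eq[of j] by (simp add: k)
  then have 4: "(gen_fun (du k) + fls_X) * (fls_X * U) = fls_X ^ Suc j + V"
    using 2 by (simp only: mult_ac)
  have "fls_X * U \<noteq> 0" using U0 X0 by simp
  then have "gen_fun (du k) + fls_X = (fls_X ^ Suc j + V) / (fls_X * U)"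
    using 4 by (simp only: eq_divide_eq simp_thms if_True)
  then have "gen_fun (du k) = (fls_X ^ Suc j + V) / (fls_X * U) - fls_X"
    by (metis add_diff_cancel_right')
  moreover have "gen_fun (ud k) = fls_X * V / U" "gen_fun (uu k) = V / U"
    "gen_fun (dd k) = (fls_X ^ Suc j + V) / U"
    using 1 2 3 U0 by (simp_all only: eq_divide_eq simp_thms if_True)
  ultimately show ?thesis unfolding idx by blast
qed

end
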